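(* For each fixed integer $C\geq -1$ and every sufficiently large $n$ (depending on $C$), the number of exceptional primitive dilation classes of $n$-element sets $A\subset\mathbb R_{>0}$ satisfying $$|\mathrm{FS}(A)|\leq T_n+n+C+1$$ is $$P(C+1)+2P(C+2)+P(C+3).$$
   Context: For a finite set $A\subset\mathbb R_{>0}$, $\mathrm{FS}(A)=\{\sum_{a\in X}a: X\subseteq A\}$ (empty sum included). Put $T_n=\binom{n+1}{2}$. For integers $u\le v$, $[u,v]_{\mathbb Z}=\{u,\dots,v\}$, empty if $u>v$. A finite set $B\subset\mathbb Z_{>0}$ is primitive if $\gcd(B)=1$. A set of the form $\lambda B$ ($\lambda>0$, $B$ primitive) has $B$ as its unique primitive normalisation; dilation classes are the classes of sets under $A\mapsto\lambda A$, $\lambda>0$, each such class being represented by its primitive normalisation. For an integer $w$, $\mathcal P(w)$ is the set of weakly increasing positive integer partitions $\pi=(\pi_1,\dots,\pi_\ell)$ with $|\pi|:=\sum_r\pi_r=w$; $\mathcal P(0)=\{()\}$ and $\mathcal P(w)=\varnothing$ for $w<0$; $\ell(\pi)$ is the number of parts. $P(w)=|\mathcal P(w)|$, so $P(0)=1$ and $P(w)=0$ for $w<0$. For $m\in\{1,2\}$, $$\mathcal E_n(m,\pi)=\bigl([1,n-\ell(\pi)+1]_{\mathbb Z}\setminus\{m\}\bigr)\cup\{\,n-\ell(\pi)+r+1+\pi_r:1\le r\le\ell(\pi)\,\}.$$ For fixed $C$ and $n$, an $n$-element set $A\subset\mathbb R_{>0}$ is exceptional if $A=\lambda\,\mathcal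 E_n(m,\pi)$ for some $\lambda>0$, $m\in\{1,2\}$ and $\pi\in\mathcal P(C+m)\cup\mathcal P(C+m+1)$. *)

theory Defs
  imports Complex_Main
begin

definition FS :: "real set \<Rightarrow> real set" where
  "FS A = {\<Sum>X | X. X \<subseteq> A}"

definition T :: "nat \<Rightarrow> nat" where
  "T n = (n + 1) choose 2"

definition partitions :: "int \<Rightarrow> int list set" where
  "partitions w = {p. sorted p \<and> (\<forall>x\<in>set p. x > 0) \<and> sum_list p = w}"

definition P :: "int \<Rightarrow> nat" where
  "P w = card (partitions w)"

(* List indices start at 0, so the r-th part of the partition p is p ! (r - 1).
   The arithmetic is over int, so that no subtraction is truncated. *)
definition E :: "nat \<Rightarrow> int \<Rightarrow> int list \<Rightarrow> int set" where
  "E n m p =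
     ({1 .. int n - int (length p) + 1} - {m}) \<union>
     {int n - int (length p) + int r + 1 + p ! (r - 1) | r. 1 \<le> r \<and> r \<le> length p}"

definition dilate :: "real \<Rightarrow> real set \<Rightarrow> real set" where
  "dilate c A = (\<lambda>x. c * x) ` A"

definition dilation :: "(real set \<times> real set) set" where
  "dilation = {(A, B). \<exists>c>0. B = dilate c A}"

lemma equiv_dilation: "equiv UNIV dilation"
proof (rule equivI)
  show "dilation \<subseteq> UNIV \<times> UNIV" by simp
  show "refl dilation"
    by (auto simp: refl_on_def dilation_def dilate_def intro!: exI[of _ 1])
  show "sym dilation"
  proof (rule symI)
    fix A B assume "(A, B) \<in> dilation"
    then obtain c where c: "c > 0" "B = dilate c A" by (auto simp: dilation_def)
    then have "A = dilate (1 / c) B" by (simp add: dilate_def image_image)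
    with c show "(B, A) \<in> dilation" by (auto simp: dilation_def intro!: exI[of _ "1 / c"])
  qed
  show "trans dilation"
  proof (rule transI)
    fix A B D assume "(A, B) \<in> dilation" "(B, D) \<in> dilation"
    then obtain c d where "c > 0" "d > 0" "B = dilate c A" "D = dilate d B"
      by (auto simp: dilation_def)
    then have "d * c > 0" "D = dilate (d * c) A"
      by (auto simp: dilate_def image_image mult.assoc)
    then show "(A, D) \<in> dilation" by (auto simp: dilation_def)
  qed
qed

(* Since Gcd {} = 0, a primitive set is nonempty. *)
definition primitive :: "int set \<Rightarrow> bool" where
  "primitive B \<longleftrightarrow> finite B \<and> B \<subseteq> {0<..} \<and> Gcd B = 1"

definition has_primitive_normalisation :: "real set \<Rightarrow> bool" where
  "has_primitive_normalisation A \<longleftrightarrow>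
     (\<exists>c>0. \<exists>B. primitive B \<and> A = dilate c (real_of_int ` B))"

definition exceptional :: "int \<Rightarrow> nat \<Rightarrow> real set \<Rightarrow> bool" where
  "exceptional C n A \<longleftrightarrow>
     finite A \<and> card A = n \<and> A \<subseteq> {0<..} \<and>
     (\<exists>c>0. \<exists>m\<in>{1, 2}. \<exists>p \<in> partitions (C + m) \<union> partitions (C + m + 1).
        A = dilate c (real_of_int ` E n m p))"

end

theory Submission
  imports Defs
begin

text \<open>
  Adding \<open>m\<close> back to \<open>E n m p\<close> gives the \<open>n + 1\<close> integers \<open>i + q\<^sub>i\<close>, where \<open>q\<close> is the partition \<open>p\<close>
  padded with zeros on the left, so \<open>p\<close> and the sum \<open>S = T (n + 1) + |p| - m\<close> can be read off.
  The subset sums lie in \<open>{0..S}\<close> and avoid \<open>m\<close> and, by complementation, \<open>S - m\<close>; hence there are at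
  most \<open>S - 1\<close> of them, and every exceptional set satisfies the bound. For large \<open>n\<close> the sets
  \<open>E n m p\<close> all contain the consecutive integers 3 and 4, so no two of them are proper dilates of
  each other, and the classes are counted by the pairs \<open>(m, p)\<close>.
\<close>

section \<open>Partitions of a fixed weight\<close>

lemma length_partition_le:
  assumes "p \<in> partitions w"
  shows "int (length p) \<le> w"
proof -
  have "int (length p) \<le> sum_list p" if "\<forall>x\<in>set p. x > 0" for p :: "int list"
    using that by (induction p) auto
  with assms show ?thesis by (auto simp: partitions_def)
qed

lemma finite_partitions: "finite (partitions w)"
proof -
  have "x \<le> sum_list p" if "\<forall>x\<in>set p. x > 0" "x \<in> set p" for x and p :: "int list"
    using that by (intro member_le_sum_list) auto
  then have "partitions w \<subseteq> {p. set p \<subseteq> {0..w} \<and> length p \<le> nat w}"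
    using length_partition_le by (fastforce simp: partitions_def)
  then show ?thesis
    using finite_lists_length_le[of "{0..w}" "nat w"] finite_subset by blast
qed

lemma partitions_disjoint: "v \<noteq> w \<Longrightarrow> partitions v \<inter> partitions w = {}"
  by (auto simp: partitions_def)

section \<open>Padded partitions and their staircases\<close>

lemma sum_Suc_lessThan: "(\<Sum>i<k. int i + 1) = int (T k)"
  by (induction k) (auto simp: T_def numeral_2_eq_2)

definition pad :: "nat \<Rightarrow> int list \<Rightarrow> int list" where
  "pad n p = replicate (Suc n - length p) 0 @ p"

definition staircase :: "int list \<Rightarrow> int list" where
  "staircase q = map (\<lambda>i. int i + 1 + q ! i) [0..<length q]"

lemma length_staircase [simp]: "length (staircase q) = length q"
  by (simp add: staircase_def)

lemma nth_staircase [simp]: "i < length q \<Longrightarrow> staircase q ! i = int i + 1 + q ! i"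
  by (simp add: staircase_def)

lemma set_staircase: "set (staircase q) = {int i + 1 + q ! i | i. i < length q}"
  by (auto simp: staircase_def)

text \<open>Adding the position makes a weakly increasing list strictly increasing, so the staircase
  has no repetitions and is determined by its set of entries.\<close>

lemma strict_sorted_staircase: "sorted q \<Longrightarrow> sorted_wrt (<) (staircase q)"
  by (auto simp: sorted_wrt_iff_nth_less sorted_iff_nth_mono add_less_le_mono)

lemma staircase_inject: "staircase p = staircase q \<Longrightarrow> p = q"
  by (metis add_left_cancel length_staircase nth_equalityI nth_staircase)

lemma sum_list_staircase: "sum_list (staircase q) = int (T (length q)) + sum_list q"
  by (simp add: sum_list_sum_nth sum.distrib atLeast0LessThan
      flip: sum_Suc_lessThan)

section \<open>The sets \<open>E n m p\<close> for large \<open>n\<close>\<close>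

locale shape =
  fixes n :: nat and m :: int and p :: "int list" and w :: int
  assumes m: "m \<in> {1, 2}" and p: "p \<in> partitions w" and n: "int n \<ge> w + 5"
begin

text \<open>Parts are at least 1, so \<open>p\<close> has at most \<open>w\<close> of them. Hence
  the initial interval of \<open>E n m p\<close> reaches at least 6, which separates the small
  elements from those given by \<open>p\<close>.\<close>

lemma length_p: "length p + 5 \<le> n"
  using length_partition_le[OF p] n by linarith

lemma length_pad: "length (pad n p) = Suc n"
  using length_p by (simp add: pad_def)

lemma sorted_pad: "sorted (pad n p)"
  using p by (force simp: pad_def partitions_def sorted_append)

text \<open>Parts are positive, so dropping the zeros undoes the padding; this lets
  \<open>E_inject\<close> recover \<open>p\<close>.\<close>

lemma filter_pad: "filter (\<lambda>x. x > 0) (pad n p) = p"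
  using p by (auto simp: pad_def partitions_def filter_id_conv)

text \<open>The \<open>n + 1 - length p\<close> leading zeros produce the interval. The
  \<open>r\<close>-th part sits at 0-based position \<open>n - length p + r\<close>, which accounts
  for the remaining entries.\<close>

lemma set_staircase_pad:
  "set (staircase (pad n p)) =
     {1 .. int n - int (length p) + 1} \<union>
     {int n - int (length p) + int r + 1 + p ! (r - 1) | r. 1 \<le> r \<and> r \<le> length p}"
  (is "_ = ?I \<union> ?J")
proof (intro equalityI subsetI)
  fix x assume "x \<in> set (staircase (pad n p))"
  then obtain i where i: "i < Suc n" "x = int i + 1 + pad n p ! i"
    by (auto simp: set_staircase length_pad)
  show "x \<in> ?I \<union> ?J"
  proof (cases "i < Suc n - length p")
    case True
    then show ?thesis using i by (auto simp: pad_def nth_append)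
  next
    case False
    define r where "r = i - (n - length p)"
    have "1 \<le> r" "r \<le> length p" "i = n - length p + r"
      using False i length_p by (auto simp: r_def)
    moreover have "x = int n - int (length p) + int r + 1 + p ! (r - 1)"
      using False i calculation length_p
      by (auto simp: pad_def nth_append Suc_diff_le of_nat_diff)
    ultimately show ?thesis by blast
  qed
next
  fix x assume "x \<in> ?I \<union> ?J"
  then show "x \<in> set (staircase (pad n p))"
  proof
    assume "x \<in> ?I"
    then have "nat (x - 1) < Suc n - length p" "x = int (nat (x - 1)) + 1"
      using length_p by auto
    then show ?thesis
      unfolding set_staircase length_pad
      by (intro CollectI exI[of _ "nat (x - 1)"]) (auto simp: pad_def nth_append)
  next
    assume "x \<in> ?J"
    then obtain r where r: "1 \<le> r" "r \<le> length p"
      "x = int n - int (length p) + int r + 1 + p ! (r - 1)" by blast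
    then show ?thesis
      unfolding set_staircase length_pad using length_p
      by (intro CollectI exI[of _ "n - length p + r"])
        (auto simp: pad_def nth_append Suc_diff_le of_nat_diff)
  qed
qed

lemma tail_gt:
  assumes "1 \<le> r" "r \<le> length p"
  shows "int n - int (length p) + int r + 1 + p ! (r - 1) > 5"
proof -
  have "p ! (r - 1) > 0" using p assms by (auto simp: partitions_def)
  then show ?thesis using length_p by linarith
qed

text \<open>In \<open>E\<close>, only the interval loses \<open>m\<close>; by \<open>tail_gt\<close>
  the other elements exceed 5, so removing \<open>m\<close> from the whole set gives the same
  result.\<close>

lemma E_eq: "E n m p = set (staircase (pad n p)) - {m}"
  unfolding E_def set_staircase_pad using m tail_gt by fastforce

lemma initial_subset: "{1..5} - {m} \<subseteq> E n m p"
  using length_p by (auto simp: E_def)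

lemma m_notin: "m \<notin> E n m p"
  by (simp add: E_eq)

lemma insert_E: "insert m (E n m p) = set (staircase (pad n p))"
  using m length_p by (auto simp: E_eq set_staircase_pad)

lemma finite_E: "finite (E n m p)"
  by (simp add: E_eq)

lemma distinct_staircase_pad: "distinct (staircase (pad n p))"
  using strict_sorted_staircase[OF sorted_pad] by (simp add: strict_sorted_iff)

lemma card_E: "card (E n m p) = n"
proof -
  have "Suc (card (E n m p)) = card (insert m (E n m p))"
    using finite_E m_notin by simp
  also have "\<dots> = Suc n"
    using distinct_card[OF distinct_staircase_pad] by (simp add: insert_E length_pad)
  finally show ?thesis by simp
qed

lemma sum_E: "\<Sum>(E n m p) = int (T n) + int n + 1 + w - m"
proof -
  have "m + \<Sum>(E n m p) = \<Sum>(set (staircase (pad n p)))"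
    using finite_E m_notin by (simp flip: insert_E)
  also have "\<dots> = sum_list (staircase (pad n p))"
    using distinct_staircase_pad by (simp add: distinct_sum_list_conv_Sum)
  also have "\<dots> = int (T (Suc n)) + w"
    using p by (simp add: sum_list_staircase length_pad)
      (simp add: pad_def partitions_def sum_list_replicate)
  finally show ?thesis by (simp add: T_def numeral_2_eq_2)
qed

lemma E_pos: "E n m p \<subseteq> {0<..}"
  using length_p tail_gt by (fastforce simp: E_def)

text \<open>Since \<open>m\<close> is at most 2, the coprime elements 3 and 4 remain.\<close>

lemma primitive_E: "primitive (E n m p)"
proof -
  have "3 \<in> E n m p" "4 \<in> E n m p" using initial_subset m by auto
  then have "Gcd (E n m p) dvd 3" "Gcd (E n m p) dvd 4" by auto
  then have "Gcd (E n m p) dvd 4 - 3" by (rule dvd_diff[rotated])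
  then have "Gcd (E n m p) = 1" by simp
  then show ?thesis using finite_E E_pos by (simp add: primitive_def)
qed

text \<open>The summands are positive and differ from \<open>m\<close>, so a sum equal to
  \<open>m\<close> could only use 1. For \<open>m = 1\<close> that element is missing, and for
  \<open>m = 2\<close> it is too small.\<close>

lemma subset_sum_ne:
  assumes "X \<subseteq> E n m p"
  shows "\<Sum>X \<noteq> m"
proof
  assume eq: "\<Sum>X = m"
  have fin: "finite X" using assms finite_E finite_subset by blast
  have "X \<subseteq> {1}"
  proof
    fix x assume x: "x \<in> X"
    have "x \<le> \<Sum>X"
      using x fin assms E_pos by (intro member_le_sum) force+
    moreover have "x > 0" "x \<noteq> m" using x assms E_pos m_notin by auto
    ultimately show "x \<in> {1}" using m eq by auto
  qed
  then have "X = {} \<or> X = {1}" by auto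
  then show False using eq m m_notin assms by auto
qed

lemma card_FS_le:
  "int (card (FS (dilate c (real_of_int ` E n m p)))) \<le> int (T n) + int n + w - m"
proof -
  define S where "S = \<Sum>(E n m p)"
  let ?N = "{0..S} - {m, S - m}"
  have range: "\<Sum>X \<in> ?N" if X: "X \<subseteq> E n m p" for X
  proof -
    have "\<Sum>(E n m p - X) + \<Sum>X = S"
      using X finite_E by (simp add: S_def sum.subset_diff)
    moreover have "\<Sum>(E n m p - X) \<noteq> m" "\<Sum>X \<noteq> m"
      using X by (auto intro!: subset_sum_ne)
    moreover have "\<Sum>X \<ge> 0" "\<Sum>(E n m p - X) \<ge> 0"
      using X E_pos by (auto intro!: sum_nonneg dest!: subsetD)
    ultimately show ?thesis by auto
  qed
  have "FS (dilate c (real_of_int ` E n m p)) \<subseteq> (\<lambda>k. c * real_of_int k) ` ?N"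
  proof
    fix y assume "y \<in> FS (dilate c (real_of_int ` E n m p))"
    then obtain Y where Y: "y = \<Sum>Y" "Y \<subseteq> (\<lambda>k. c * real_of_int k) ` E n m p"
      by (auto simp: FS_def dilate_def image_image)
    \<comment> \<open>Scaling may fail to be injective, as \<open>c = 0\<close> is allowed here;
      \<open>X\<close> therefore picks one preimage for each element of \<open>Y\<close>.\<close>
    then obtain X where X: "X \<subseteq> E n m p" "Y = (\<lambda>k. c * real_of_int k) ` X"
        "inj_on (\<lambda>k. c * real_of_int k) X"
      by (metis subset_image_inj)
    then have "y = c * real_of_int (\<Sum>X)"
      using Y by (simp add: sum.reindex sum_distrib_left)
    then show "y \<in> (\<lambda>k. c * real_of_int k) ` ?N" using range[OF X(1)] by blast
  qed
  then have "card (FS (dilate c (real_of_int ` E n m p))) \<le> card ?N"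
    by (rule surj_card_le[rotated]) simp
  moreover have "int (card ?N) = S - 1"
  proof -
    \<comment> \<open>Since \<open>S\<close> is at least 12 and \<open>m\<close> at most 2, the
      excluded values \<open>m\<close> and \<open>S - m\<close> are distinct and lie in the range,
      so exactly two of its \<open>S + 1\<close> integers are lost.\<close>
    have "\<Sum>{3, 4, 5} \<le> S"
      unfolding S_def using initial_subset m finite_E E_pos by (intro sum_mono2) auto
    then have "m \<noteq> S - m" "{m, S - m} \<subseteq> {0..S}" "S \<ge> 12" using m by auto
    then show ?thesis by (simp add: card_Diff_subset)
  qed
  ultimately show ?thesis by (simp add: S_def sum_E)
qed

end

section \<open>Rigidity under dilation\<close>

lemma integral_dilation_Ints:
  assumes "k \<in> A" "k + 1 \<in> A" "dilate c (real_of_int ` A) \<subseteq> \<int>"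
  shows "c \<in> \<int>"
proof -
  have "c * real_of_int (k + 1) \<in> \<int>" "c * real_of_int k \<in> \<int>"
    using assms unfolding dilate_def by blast+
  then have "c * real_of_int (k + 1) - c * real_of_int k \<in> \<int>" by (rule Ints_diff)
  then show ?thesis by (simp add: algebra_simps)
qed

text \<open>Differences of consecutive elements show that the dilation factor and its inverse are
  both integers; being positive, the factor is 1.\<close>

lemma dilation_consecutive_eq:
  assumes "(real_of_int ` A, real_of_int ` B) \<in> dilation"
    and "k \<in> A" "k + 1 \<in> A" "l \<in> B" "l + 1 \<in> B"
  shows "A = B"
proof -
  obtain c where c: "c > 0" "real_of_int ` B = dilate c (real_of_int ` A)"
    using assms(1) by (auto simp: dilation_def)
  then have inv: "real_of_int ` A = dilate (1 / c) (real_of_int ` B)"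
    by (simp add: dilate_def image_image)
  have "real_of_int ` A \<subseteq> \<int>" "real_of_int ` B \<subseteq> \<int>" by auto
  then have "c \<in> \<int>" "1 / c \<in> \<int>"
    using integral_dilation_Ints[OF assms(2,3), of c] integral_dilation_Ints[OF assms(4,5), of "1 / c"]
    unfolding c(2)[symmetric] inv[symmetric] by blast+
  then obtain a b where ab: "c = of_int a" "1 / c = of_int b" by (auto elim!: Ints_cases)
  then have "real_of_int (a * b) = 1" using c(1) by (simp add: field_simps)
  then have "a * b = 1" by linarith
  then have "c = 1" using ab c(1) by (auto simp: zmult_eq_1_iff)
  then have "real_of_int ` B = real_of_int ` A"
    using c(2) by (simp add: dilate_def)
  then show ?thesis by (simp add: inj_image_eq_iff inj_on_def)
qed

text \<open>Among 1 to 5 only \<open>m\<close> is missing, so the set determines \<open>m\<close>.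
  Adding it back gives the set of a strictly increasing staircase, hence the staircase and then
  \<open>p\<close>.\<close>

lemma E_inject:
  assumes "shape n m p w" "shape n m' p' w'" "E n m p = E n m' p'"
  shows "m = m' \<and> p = p'"
proof -
  interpret A: shape n m p w by fact
  interpret B: shape n m' p' w' by fact
  have "m' \<in> {1..5}" using B.m by auto
  then have "m = m'"
    using A.initial_subset B.m_notin assms(3) by blast
  then have "set (staircase (pad n p)) = set (staircase (pad n p'))"
    using assms(3) by (simp flip: A.insert_E B.insert_E)
  then have "staircase (pad n p) = staircase (pad n p')"
    using strict_sorted_staircase[OF A.sorted_pad] strict_sorted_staircase[OF B.sorted_pad]
    by (simp add: strict_sorted_equal)
  then have "pad n p = pad n p'" by (rule staircase_inject)
  then show ?thesis using A.filter_pad B.filter_pad \<open>m = m'\<close> by metis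
qed

section \<open>Counting the classes\<close>

theorem corollary1p2:
  fixes C :: int
  assumes "C \<ge> -1"
  shows "\<forall>\<^sub>F n in sequentially.
    card ({A. exceptional C n A \<and> has_primitive_normalisation A \<and>
              int (card (FS A)) \<le> int (T n) + int n + C + 1} // dilation)
      = P (C + 1) + 2 * P (C + 2) + P (C + 3)"
\<comment> \<open>The weight is at most \<open>C + m + 1\<close>, hence at most
  \<open>C + 3\<close>, and the locale \<open>shape\<close> requires \<open>n\<close> to be at least
  the weight plus 5.\<close>
proof (rule eventually_sequentiallyI[of "nat (C + 8)"])
  fix n assume "n \<ge> nat (C + 8)"
  then have n: "int n \<ge> C + 8" by linarith
  define S where "S = {A. exceptional C n A \<and> has_primitive_normalisation A \<and>
              int (card (FS A)) \<le> int (T n) + int n + C + 1}"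
  define I where "I = (SIGMA m:{1, 2}. partitions (C + m) \<union> partitions (C + m + 1))"
  define B where "B = (\<lambda>(m, p). real_of_int ` E n m p)"
  \<comment> \<open>The upper bound gives \<open>w - m \<le> C + 1\<close>, which turns
    \<open>card_FS_le\<close> into the required inequality.\<close>
  have shape: "\<exists>w. shape n m p w \<and> w \<le> C + m + 1" if "(m, p) \<in> I" for m p
    using that n by (fastforce simp: I_def shape_def)
  have mem: "dilate c (B x) \<in> S" if x: "x \<in> I" and c: "c > 0" for x c
  proof -
    obtain m p where mp: "x = (m, p)" by (cases x)
    then obtain w where "shape n m p w" and w: "w \<le> C + m + 1" using shape x by blast
    then interpret shape n m p w by simp
    have inj: "inj_on (\<lambda>k. c * real_of_int k) (E n m p)" using c by (auto simp: inj_on_def)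
    have "exceptional C n (dilate c (B x))"
      unfolding exceptional_def
    proof (intro conjI)
      have "m \<in> {1, 2}" "p \<in> partitions (C + m) \<union> partitions (C + m + 1)"
        using x by (auto simp: mp I_def)
      then show "\<exists>d>0. \<exists>m\<in>{1, 2}. \<exists>p\<in>partitions (C + m) \<union> partitions (C + m + 1).
          dilate c (B x) = dilate d (real_of_int ` E n m p)"
        using c unfolding B_def mp prod.case by blast
    qed (use finite_E E_pos c card_image[OF inj] card_E in
        \<open>auto simp: B_def mp dilate_def image_image\<close>)
    moreover have "has_primitive_normalisation (dilate c (B x))"
      unfolding has_primitive_normalisation_def B_def mp using c primitive_E by auto
    ultimately show ?thesis
      using card_FS_le[of c] w by (simp add: S_def B_def mp)
  qed
  have dil: "(B x, dilate c (B x)) \<in> dilation" if "c > 0" for x c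
    using that by (auto simp: dilation_def)
  have "S // dilation = (\<lambda>x. dilation `` {B x}) ` I"
  proof (intro equalityI subsetI)
    fix Q assume "Q \<in> S // dilation"
    then obtain A where A: "A \<in> S" "Q = dilation `` {A}" by (auto elim: quotientE)
    then obtain c m p where "c > 0" "m \<in> {1, 2}" "p \<in> partitions (C + m) \<union> partitions (C + m + 1)"
        and "A = dilate c (real_of_int ` E n m p)"
      unfolding S_def exceptional_def by blast
    then have "c > 0" "(m, p) \<in> I" "A = dilate c (B (m, p))"
      unfolding I_def B_def prod.case by blast+
    then show "Q \<in> (\<lambda>x. dilation `` {B x}) ` I"
      using A dil equiv_class_eq[OF equiv_dilation] by blast
  next
    fix Q assume "Q \<in> (\<lambda>x. dilation `` {B x}) ` I"
    then obtain x where "x \<in> I" "Q = dilation `` {B x}" by blast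
    moreover have "dilate 1 (B x) = B x" by (simp add: dilate_def)
    ultimately show "Q \<in> S // dilation" using mem[of x 1] by (auto intro: quotientI)
  qed
  moreover have "inj_on (\<lambda>x. dilation `` {B x}) I"
  proof (rule inj_onI)
    fix x y assume xy: "x \<in> I" "y \<in> I" "dilation `` {B x} = dilation `` {B y}"
    obtain m p m' p' where mp: "x = (m, p)" "y = (m', p')" by (metis surj_pair)
    obtain v w where vw: "shape n m p v" "shape n m' p' w"
      using shape xy mp by blast
    have "(B x, B y) \<in> dilation"
      using xy(3) eq_equiv_class[OF _ equiv_dilation] by blast
    moreover have "3 \<in> E n m p" "3 + 1 \<in> E n m p" "3 \<in> E n m' p'" "3 + 1 \<in> E n m' p'"
      using shape.initial_subset[OF vw(1)] shape.initial_subset[OF vw(2)]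
        shape.m[OF vw(1)] shape.m[OF vw(2)] by auto
    ultimately have "E n m p = E n m' p'"
      unfolding B_def mp by (auto dest: dilation_consecutive_eq)
    then show "x = y" using E_inject[OF vw] mp by simp
  qed
  ultimately have "card (S // dilation) = card I" by (simp add: card_image)
  \<comment> \<open>The weights are \<open>C + 1\<close> and \<open>C + 2\<close> for
    \<open>m = 1\<close>, and \<open>C + 2\<close> and \<open>C + 3\<close> for
    \<open>m = 2\<close>; the shared weight gives the factor 2.\<close>
  also have "\<dots> = P (C + 1) + 2 * P (C + 2) + P (C + 3)"
    unfolding I_def P_def
    by (simp add: card_SigmaI finite_partitions card_Un_disjoint partitions_disjoint add.assoc)
  finally show "card ({A. exceptional C n A \<and> has_primitive_normalisation A \<and>
              int (card (FS A)) \<le> int (T n) + int n + C + 1} // dilation)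
      = P (C + 1) + 2 * P (C + 2) + P (C + 3)"
    unfolding S_def .
qed

end
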